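(* Let $G$ be a compact Hausdorff topological group and let $\Gamma$ be a countable normal subgroup of $G$. Then $\Gamma$ is locally virtually abelian, i.e., every finitely generated subgroup of $\Gamma$ is virtually abelian.
   Context: Countable means finite or countably infinite. A group is virtually abelian if it has an abelian subgroup of finite index. *)

theory Defs
  imports "HOL-Analysis.Analysis" "HOL-Algebra.Generated_Groups"
begin

locale topological_group = group G for G (structure) +
  fixes T :: "'a topology"
  assumes topspace_eq_carrier: "topspace T = carrier G"
    and continuous_mult: "continuous_map (prod_topology T T) T (\<lambda>(x, y). x \<otimes> y)"
    and continuous_inv: "continuous_map T T (\<lambda>x. inv x)"

text \<open>The predicates below are meant for groups; a subgroup \<open>H\<close> of \<open>G\<close> is regarded as a group
  in its own right by means of the record \<open>G\<lparr>carrier := H\<rparr>\<close>.\<close>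

definition finitely_generated_group :: "('a, 'b) monoid_scheme \<Rightarrow> bool" where
  "finitely_generated_group G \<longleftrightarrow>
     (\<exists>S. finite S \<and> S \<subseteq> carrier G \<and> generate G S = carrier G)"

definition virtually_abelian :: "('a, 'b) monoid_scheme \<Rightarrow> bool" where
  "virtually_abelian G \<longleftrightarrow>
     (\<exists>A. subgroup A G \<and> comm_group (G\<lparr>carrier := A\<rparr>) \<and> finite (rcosets\<^bsub>G\<^esub> A))"

definition locally_virtually_abelian :: "('a, 'b) monoid_scheme \<Rightarrow> bool" where
  "locally_virtually_abelian G \<longleftrightarrow>
     (\<forall>H. subgroup H G \<and> finitely_generated_group (G\<lparr>carrier := H\<rparr>)
        \<longrightarrow> virtually_abelian (G\<lparr>carrier := H\<rparr>))"

end

theory Submission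
  imports Defs
begin

text \<open>For \<open>x \<in> \<Gamma>\<close> the map \<open>g \<mapsto> g\<^sup>-\<^sup>1xg\<close> has countably many values, so by the Baire category
  theorem one of its fibres, which are closed, has an interior point. The fibres are the right cosets
  of the centraliser of \<open>x\<close>, so all of them are open, and by compactness there are only finitely
  many. Hence every \<open>x \<in> \<Gamma>\<close> has finitely many conjugates. In a subgroup \<open>H\<close> of \<open>\<Gamma>\<close> generated by a
  finite set \<open>S\<close>, the centre is the intersection of the finitely many centralisers of the elements of
  \<open>S\<close>, all of finite index; so the centre is an abelian subgroup of finite index.\<close>

lemma (in group) conj_mult:
  assumes "x \<in> carrier G" "g \<in> carrier G" "h \<in> carrier G"
  shows "inv (g \<otimes> h) \<otimes> x \<otimes> (g \<otimes> h) = inv h \<otimes> (inv g \<otimes> x \<otimes> g) \<otimes> h"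
  using assms by (simp add: inv_mult_group m_assoc)

lemma (in topological_group) continuous_map_conj:
  assumes "x \<in> carrier G"
  shows "continuous_map T T (\<lambda>g. inv g \<otimes> x \<otimes> g)"
proof -
  have mult: "continuous_map T T (\<lambda>g. f g \<otimes> h g)"
    if "continuous_map T T f" "continuous_map T T h" for f h
    using continuous_map_compose[OF continuous_map_pairedI[OF that] continuous_mult]
    by (simp add: o_def)
  show ?thesis
    using assms by (intro mult continuous_inv) (auto simp: topspace_eq_carrier)
qed

text \<open>Makes right translates of open sets open, so that a single open set can be moved to
  every point of the group.\<close>

lemma (in topological_group) continuous_map_right_mult:
  assumes "k \<in> carrier G"
  shows "continuous_map T T (\<lambda>g. g \<otimes> k)"
proof -
  have "continuous_map T (prod_topology T T) (\<lambda>g. (g, k))"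
    using assms by (intro continuous_map_pairedI) (auto simp: topspace_eq_carrier)
  from continuous_map_compose[OF this continuous_mult] show ?thesis
    by (simp add: o_def)
qed

lemma (in topological_group) finite_conjugates:
  assumes compact: "compact_space T" and Haus: "Hausdorff_space T" and x: "x \<in> carrier G"
    and count: "countable ((\<lambda>g. inv g \<otimes> x \<otimes> g) ` carrier G)"
  shows "finite ((\<lambda>g. inv g \<otimes> x \<otimes> g) ` carrier G)"
proof -
  define f where "f = (\<lambda>g. inv g \<otimes> x \<otimes> g)"
  have f_closed: "f g \<in> carrier G" if "g \<in> carrier G" for g
    using that x by (simp add: f_def)
  have f_mult: "f (g \<otimes> h) = inv h \<otimes> f g \<otimes> h" if "g \<in> carrier G" "h \<in> carrier G" for g h
    using conj_mult[OF x that] by (simp add: f_def)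
  define F where "F c = {g \<in> topspace T. f g \<in> {c}}" for c
  have closed: "closedin T (F c)" if "c \<in> f ` carrier G" for c
  proof -
    have "closedin T {c}"
      using that f_closed Haus by (auto simp: closedin_Hausdorff_sing_eq topspace_eq_carrier)
    thus ?thesis
      unfolding F_def f_def by (rule closedin_continuous_map_preimage[OF continuous_map_conj[OF x]])
  qed
  have "\<Union> (F ` f ` carrier G) = topspace T"
    by (auto simp: F_def topspace_eq_carrier)
  \<comment> \<open>The union is the whole space, which contains \<one>. If each of the countably
    many closed fibres had empty interior, Baire would give this union empty interior too.\<close>
  hence "T interior_of \<Union> (F ` f ` carrier G) \<noteq> {}"
    using one_closed topspace_eq_carrier interior_of_topspace[of T] by auto
  moreover have "locally_compact_space T" "regular_space T"
    using compact Haus compact_imp_locally_compact_space compact_Hausdorff_imp_regular_space by auto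
  moreover have "countable (F ` f ` carrier G)"
    using count by (simp add: f_def)
  ultimately obtain c where c: "T interior_of F c \<noteq> {}"
    using Baire_category_alt[of T "F ` f ` carrier G"] closed by blast
  define V where "V = T interior_of F c"
  have V: "openin T V" "V \<subseteq> F c"
    by (simp_all add: V_def interior_of_subset)
  obtain v where v: "v \<in> V" using c V_def by blast
  have V_carrier: "V \<subseteq> carrier G" and fV: "\<And>w. w \<in> V \<Longrightarrow> f w = f v"
    using V v by (auto simp: F_def topspace_eq_carrier)
  \<comment> \<open>\<open>W g\<close> is the translate of \<open>V\<close> by
    \<open>inv v \<otimes> g\<close>, which carries \<open>v\<close> to \<open>g\<close>. Writing it
    as a preimage under a right multiplication gives openness at once.\<close>
  define W where "W g = {h \<in> topspace T. h \<otimes> (inv g \<otimes> v) \<in> V}" for g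
  have W_open: "openin T (W g)" if "g \<in> carrier G" for g
    unfolding W_def using that v V V_carrier
    by (intro openin_continuous_map_preimage[where Y = T] continuous_map_right_mult) auto
  have W_self: "g \<in> W g" if "g \<in> carrier G" for g
    using that v V_carrier by (auto simp: W_def topspace_eq_carrier m_assoc[symmetric] subset_iff)
  have W_const: "f h = f g" if g: "g \<in> carrier G" and h: "h \<in> W g" for g h
  proof -
    \<comment> \<open>Here \<open>g = v \<otimes> k\<close> and \<open>h = w \<otimes> k\<close>
      with \<open>w\<close> in \<open>V\<close>. By \<open>f_mult\<close>, the value of
      \<open>f\<close> at a product with right factor \<open>k\<close> depends only on
      \<open>k\<close> and the value at the left factor, and \<open>f\<close> is constant on
      \<open>V\<close>.\<close>
    define k where "k = inv v \<otimes> g"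
    have vG: "v \<in> carrier G" and hG: "h \<in> carrier G"
      using v V_carrier h by (auto simp: W_def topspace_eq_carrier)
    have k: "k \<in> carrier G" "inv k = inv g \<otimes> v" using vG g by (auto simp: k_def inv_mult_group)
    have w: "h \<otimes> inv k \<in> V" using h k by (simp add: W_def)
    have "f h = f ((h \<otimes> inv k) \<otimes> k)" using hG k(1) by (simp add: m_assoc)
    also have "\<dots> = inv k \<otimes> f v \<otimes> k" using f_mult[of "h \<otimes> inv k" k] hG k(1) fV[OF w] by simp
    also have "\<dots> = f (v \<otimes> k)" using f_mult[OF vG k(1)] by simp
    also have "v \<otimes> k = g" using vG g by (simp add: k_def m_assoc[symmetric])
    finally show ?thesis .
  qed
  \<comment> \<open>Finitely many translates cover the group and \<open>f\<close> is constant on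
    each, so the values at their base points \<open>B\<close> are all the values of
    \<open>f\<close>.\<close>
  obtain \<F> where \<F>: "finite \<F>" "\<F> \<subseteq> W ` carrier G" "topspace T \<subseteq> \<Union>\<F>"
  proof -
    have "\<forall>U\<in>W ` carrier G. openin T U" "topspace T \<subseteq> \<Union> (W ` carrier G)"
      using W_open W_self by (auto simp: topspace_eq_carrier)
    thus thesis using compact that unfolding compact_space_alt by meson
  qed
  obtain B where B: "finite B" "B \<subseteq> carrier G" "\<F> = W ` B"
    using finite_subset_image[OF \<F>(1,2)] by blast
  have "f ` carrier G \<subseteq> f ` B"
  proof
    fix y assume "y \<in> f ` carrier G"
    then obtain h where h: "h \<in> carrier G" "y = f h" by blast
    then obtain g where "g \<in> B" "h \<in> W g" using \<F>(3) B(3) by (auto simp: topspace_eq_carrier)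
    thus "y \<in> f ` B" using W_const B(2) h by blast
  qed
  thus ?thesis using B(1) finite_surj unfolding f_def by blast
qed

text \<open>Applied twice below: to the generating set, where it yields the abelian subgroup, and to
  a singleton, where it extends commutation from generators to the whole group.\<close>

lemma (in group) subgroup_centralizer:
  assumes "S \<subseteq> carrier G"
  shows "subgroup {a \<in> carrier G. \<forall>s\<in>S. a \<otimes> s = s \<otimes> a} G"
proof (rule subgroupI; clarsimp?)
  show "\<exists>a. a \<in> carrier G \<and> (\<forall>s\<in>S. a \<otimes> s = s \<otimes> a)"
    using assms by (intro exI[of _ \<one>]) auto
next
  fix a s assume "a \<in> carrier G" "\<forall>s\<in>S. a \<otimes> s = s \<otimes> a" "s \<in> S"
  hence a: "a \<in> carrier G" "s \<in> carrier G" "a \<otimes> s = s \<otimes> a"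
    using assms by auto
  have "inv a \<otimes> s = inv a \<otimes> (s \<otimes> a) \<otimes> inv a" using a(1,2) by (simp add: m_assoc)
  also have "\<dots> = inv a \<otimes> (a \<otimes> s) \<otimes> inv a" using a(3) by simp
  also have "\<dots> = s \<otimes> inv a" using a(1,2) by (simp add: m_assoc[symmetric])
  finally show "inv a \<otimes> s = s \<otimes> inv a" .
next
  fix a b s
  assume "a \<in> carrier G" "\<forall>s\<in>S. a \<otimes> s = s \<otimes> a" "b \<in> carrier G" "\<forall>s\<in>S. b \<otimes> s = s \<otimes> b" "s \<in> S"
  thus "a \<otimes> b \<otimes> s = s \<otimes> (a \<otimes> b)"
    using assms by (metis m_assoc subsetD)
qed

lemma (in group) virtually_abelian_if_finite_conjugates:
  assumes S: "finite S" "S \<subseteq> carrier G" "generate G S = carrier G"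
    and fin: "\<And>s. s \<in> S \<Longrightarrow> finite ((\<lambda>g. inv g \<otimes> s \<otimes> g) ` carrier G)"
  shows "virtually_abelian G"
proof -
  define A where "A = {a \<in> carrier G. \<forall>s\<in>S. a \<otimes> s = s \<otimes> a}"
  have A: "subgroup A G"
    unfolding A_def using S(2) by (rule subgroup_centralizer)
  have "a \<otimes> b = b \<otimes> a" if a: "a \<in> A" and b: "b \<in> carrier G" for a b
  proof -
    have aG: "a \<in> carrier G" using a by (simp add: A_def)
    \<comment> \<open>The roles are reversed: the centralizer of \<open>a\<close> is a subgroup
      containing \<open>S\<close>, hence everything. So \<open>A\<close> is the centre.\<close>
    have "S \<subseteq> {b \<in> carrier G. \<forall>c\<in>{a}. b \<otimes> c = c \<otimes> b}"
      using a S(2) by (auto simp: A_def)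
    from generate_subgroup_incl[OF this subgroup_centralizer] show ?thesis
      using aG b S(3) by auto
  qed
  hence "comm_group (G\<lparr>carrier := A\<rparr>)"
    using A subgroup.subgroup_is_group[OF A is_group] subgroup.subset[OF A]
    by (intro group.group_comm_groupI) auto
  moreover have "finite (rcosets A)"
  proof -
    \<comment> \<open>The index of \<open>A\<close> is bounded by the number of tuples of conjugates
      of the generators. Restricting the function to \<open>S\<close> places these tuples in a
      finite product of finite conjugacy classes.\<close>
    define \<phi> where "\<phi> g = (\<lambda>s\<in>S. inv g \<otimes> s \<otimes> g)" for g
    have "\<phi> ` carrier G \<subseteq> (\<Pi>\<^sub>E s\<in>S. (\<lambda>g. inv g \<otimes> s \<otimes> g) ` carrier G)"
      by (auto simp: \<phi>_def)
    hence fin_\<phi>: "finite (\<phi> ` carrier G)"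
      by (rule finite_subset) (intro finite_PiE S fin)
    have same: "A #> h = A #> g"
      if g: "g \<in> carrier G" and h: "h \<in> carrier G" and eq: "\<phi> g = \<phi> h" for g h
    proof -
      \<comment> \<open>Equal conjugates of \<open>s\<close> by \<open>g\<close> and
        \<open>h\<close>, multiplied by \<open>g\<close> on the left and \<open>inv h\<close> on the
        right, say that \<open>g \<otimes> inv h\<close> commutes with \<open>s\<close>.\<close>
      have "(g \<otimes> inv h) \<otimes> s = s \<otimes> (g \<otimes> inv h)" if s: "s \<in> S" for s
      proof -
        have sG: "s \<in> carrier G" using s S(2) by blast
        have "inv g \<otimes> s \<otimes> g = inv h \<otimes> s \<otimes> h"
          using fun_cong[OF eq, of s] s by (simp add: \<phi>_def)
        hence "g \<otimes> (inv g \<otimes> s \<otimes> g) \<otimes> inv h = g \<otimes> (inv h \<otimes> s \<otimes> h) \<otimes> inv h" by simp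
        moreover have "g \<otimes> (inv g \<otimes> s \<otimes> g) \<otimes> inv h = s \<otimes> (g \<otimes> inv h)"
          using g h sG by (simp add: m_assoc[symmetric])
        moreover have "g \<otimes> (inv h \<otimes> s \<otimes> h) \<otimes> inv h = (g \<otimes> inv h) \<otimes> s"
          using g h sG by (simp add: m_assoc)
        ultimately show ?thesis by simp
      qed
      hence "g \<otimes> inv h \<in> A" using g h by (simp add: A_def)
      hence "g \<in> A #> h" using subgroup.rcos_module_rev[OF A is_group h g] by simp
      thus ?thesis using repr_independence[OF _ h A] by simp
    qed
    \<comment> \<open>By \<open>same\<close>, a tuple determines its coset, so any chosen
      representative of the tuple recovers it.\<close>
    have "rcosets A \<subseteq> (\<lambda>p. A #> (SOME g. g \<in> carrier G \<and> \<phi> g = p)) ` \<phi> ` carrier G"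
    proof
      fix R assume "R \<in> rcosets A"
      then obtain g where g: "g \<in> carrier G" "R = A #> g" by (auto simp: RCOSETS_def)
      define k where "k = (SOME k. k \<in> carrier G \<and> \<phi> k = \<phi> g)"
      have "k \<in> carrier G \<and> \<phi> k = \<phi> g"
        unfolding k_def by (rule someI[where x = g]) (simp add: g)
      hence "R = A #> k" using same g by metis
      thus "R \<in> (\<lambda>p. A #> (SOME g. g \<in> carrier G \<and> \<phi> g = p)) ` \<phi> ` carrier G"
        using g(1) by (simp add: k_def)
    qed
    thus ?thesis using fin_\<phi> finite_surj by (meson finite_imageI finite_subset)
  qed
  ultimately show ?thesis using A unfolding virtually_abelian_def by blast
qed

theorem theorem2:
  fixes G :: "('a, 'b) monoid_scheme" and T :: "'a topology" and \<Gamma> :: "'a set"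
  assumes "topological_group G T"
    and "compact_space T"
    and "Hausdorff_space T"
    and "\<Gamma> \<lhd> G"
    and "countable \<Gamma>"
  shows "locally_virtually_abelian (G\<lparr>carrier := \<Gamma>\<rparr>)"
proof -
  interpret topological_group G T by fact
  interpret N: normal \<Gamma> G by fact
  have fin: "finite ((\<lambda>g. inv\<^bsub>G\<^esub> g \<otimes>\<^bsub>G\<^esub> x \<otimes>\<^bsub>G\<^esub> g) ` carrier G)" if x: "x \<in> \<Gamma>" for x
  proof (rule finite_conjugates)
    \<comment> \<open>Normality keeps all conjugates of \<open>x\<close> inside the countable set
      \<Gamma>.\<close>
    show "countable ((\<lambda>g. inv\<^bsub>G\<^esub> g \<otimes>\<^bsub>G\<^esub> x \<otimes>\<^bsub>G\<^esub> g) ` carrier G)"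
      using N.inv_op_closed1 x by (intro countable_subset[OF _ \<open>countable \<Gamma>\<close>]) auto
  qed (use assms x N.subset in auto)
  have "virtually_abelian (G\<lparr>carrier := H\<rparr>)"
    if H: "subgroup H (G\<lparr>carrier := \<Gamma>\<rparr>)" and fg: "finitely_generated_group (G\<lparr>carrier := H\<rparr>)" for H
  proof -
    have HG: "subgroup H G" using incl_subgroup[OF N.subgroup_axioms H] .
    have H\<Gamma>: "H \<subseteq> \<Gamma>" using subgroup.subset[OF H] by simp
    obtain S where S: "finite S" "S \<subseteq> H" "generate (G\<lparr>carrier := H\<rparr>) S = H"
      using fg by (auto simp: finitely_generated_group_def)
    show ?thesis
    proof (rule group.virtually_abelian_if_finite_conjugates[where S = S])
      show "group (G\<lparr>carrier := H\<rparr>)" using subgroup.subgroup_is_group[OF HG is_group] .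
      fix s assume "s \<in> S"
      hence "s \<in> \<Gamma>" using S(2) H\<Gamma> by blast
      \<comment> \<open>Inverses in \<open>H\<close> agree with those in \<open>G\<close>, so
        conjugating by elements of \<open>H\<close> only gives part of the finite class under
        \<open>G\<close>.\<close>
      have "(\<lambda>g. inv\<^bsub>G\<lparr>carrier := H\<rparr>\<^esub> g \<otimes>\<^bsub>G\<^esub> s \<otimes>\<^bsub>G\<^esub> g) ` H
              \<subseteq> (\<lambda>g. inv\<^bsub>G\<^esub> g \<otimes>\<^bsub>G\<^esub> s \<otimes>\<^bsub>G\<^esub> g) ` carrier G"
        using subgroup.subset[OF HG] HG by auto
      thus "finite ((\<lambda>g. inv\<^bsub>G\<lparr>carrier := H\<rparr>\<^esub> g \<otimes>\<^bsub>G\<lparr>carrier := H\<rparr>\<^esub> s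
              \<otimes>\<^bsub>G\<lparr>carrier := H\<rparr>\<^esub> g) ` carrier (G\<lparr>carrier := H\<rparr>))"
        using finite_subset[OF _ fin[OF \<open>s \<in> \<Gamma>\<close>]] by simp
    qed (use S in auto)
  qed
  thus ?thesis by (simp add: locally_virtually_abelian_def)
qed

end
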